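(* Let $q\ge2$ be a prime power, let $n\ge5$, and let $x$ be the unique positive real solution of $\log_q(x+1)=x-\binom{n}{\lfloor n/2\rfloor}$. Then $\operatorname{Trank}(\det^n_{\mathbb{F}_q})\ge\lceil x\rceil$. In particular, $\operatorname{Trank}(\det^n_{\mathbb{F}_q})\ge\binom{n}{\lfloor n/2\rfloor}+\log_q\binom{n}{\lfloor n/2\rfloor}$.
   Context: $\mathbb{F}_q$ is the field with $q$ elements. $\det^n_{\mathbb{F}_q}=\sum_{\sigma\in S_n}\operatorname{sgn}(\sigma)\mathbf{e}_{\sigma(1)}\otimes\cdots\otimes\mathbf{e}_{\sigma(n)}\in(\mathbb{F}_q^n)^{\otimes n}$, and $\operatorname{Trank}$ is tensor rank (least number of elementary tensors $\mathbf{v_1}\otimes\cdots\otimes\mathbf{v_n}$ summing to the tensor). *)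

theory Defs
  imports
    Complex_Main
    "HOL-Library.FuncSet"
    "HOL-Combinatorics.Permutations"
    "HOL-Number_Theory.Prime_Powers"
    "Jordan_Normal_Form.Matrix"
begin

text \<open>
  A tensor in \<open>(F\<^sup>n)\<close> to the tensor power \<open>d\<close> is represented by its coordinates with respect to
  the standard basis, a function on the multi-indices \<open>i\<close> with \<open>i k < n\<close> for \<open>k < d\<close>.
  Arguments that are not such multi-indices are mapped to \<open>0\<close>, so that equality of tensors is
  equality of functions. Tensor factors and basis vectors are numbered from \<open>0\<close>.
\<close>

type_synonym 'a tensor = "(nat \<Rightarrow> nat) \<Rightarrow> 'a"

definition multi_indices :: "nat \<Rightarrow> nat \<Rightarrow> (nat \<Rightarrow> nat) set" where
  "multi_indices d n = {..<d} \<rightarrow>\<^sub>E {..<n}"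

definition elementary_tensor :: "nat \<Rightarrow> nat \<Rightarrow> (nat \<Rightarrow> 'a::field vec) \<Rightarrow> 'a tensor" where
  "elementary_tensor d n v =
     (\<lambda>i. if i \<in> multi_indices d n then \<Prod>k<d. v k $ i k else 0)"

definition sum_of_elementary_tensors :: "nat \<Rightarrow> nat \<Rightarrow> nat \<Rightarrow> 'a::field tensor \<Rightarrow> bool" where
  "sum_of_elementary_tensors d n r T \<longleftrightarrow>
     (\<exists>v :: nat \<Rightarrow> nat \<Rightarrow> 'a vec.
        (\<forall>j<r. \<forall>k<d. v j k \<in> carrier_vec n) \<and>
        T = (\<lambda>i. \<Sum>j<r. elementary_tensor d n (v j) i))"

definition tensor_rank :: "nat \<Rightarrow> nat \<Rightarrow> 'a::field tensor \<Rightarrow> nat" where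
  "tensor_rank d n T = (LEAST r. sum_of_elementary_tensors d n r T)"

definition det_tensor :: "nat \<Rightarrow> 'a::field tensor" where
  "det_tensor n =
     (\<lambda>i. \<Sum>\<sigma> | \<sigma> permutes {..<n}.
        of_int (sign \<sigma>) * elementary_tensor n n (\<lambda>k. unit_vec n (\<sigma> k)) i)"

text \<open>
  The set over which the minimum in \<open>tensor_rank\<close> is taken is nonempty for the determinant tensor.
\<close>

lemma det_tensor_sum_of_elementary_tensors:
  assumes "0 < n"
  shows "\<exists>r. sum_of_elementary_tensors n n r (det_tensor n :: 'a::field tensor)"
proof -
  let ?P = "{\<sigma>. \<sigma> permutes {..<n}}"
  have "finite ?P"
    by (simp add: finite_permutations)
  then obtain h where h: "bij_betw h {..<card ?P} ?P"
    using ex_bij_betw_nat_finite[of ?P] by (auto simp: atLeast0LessThan)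
  define c :: "(nat \<Rightarrow> nat) \<Rightarrow> nat \<Rightarrow> 'a"
    where "c \<sigma> k = (if k = 0 then of_int (sign \<sigma>) else 1)" for \<sigma> k
  define w :: "(nat \<Rightarrow> nat) \<Rightarrow> nat \<Rightarrow> 'a vec"
    where "w \<sigma> k = c \<sigma> k \<cdot>\<^sub>v unit_vec n (\<sigma> k)" for \<sigma> k
  have c: "(\<Prod>k<n. c \<sigma> k) = of_int (sign \<sigma>)" for \<sigma>
    using assms by (simp add: c_def prod.delta)
  have w: "elementary_tensor n n (w \<sigma>) i =
      of_int (sign \<sigma>) * elementary_tensor n n (\<lambda>k. unit_vec n (\<sigma> k)) i" for \<sigma> i
  proof (cases "i \<in> multi_indices n n")
    case True
    then have "i k < n" if "k < n" for k
      using that by (auto simp: multi_indices_def PiE_def Pi_def)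
    then have "(\<Prod>k<n. w \<sigma> k $ i k) = (\<Prod>k<n. c \<sigma> k * unit_vec n (\<sigma> k) $ i k)"
      by (intro prod.cong) (auto simp: w_def)
    then show ?thesis
      using True by (simp add: elementary_tensor_def prod.distrib c)
  qed (simp add: elementary_tensor_def)
  have "det_tensor n = (\<lambda>i. \<Sum>j<card ?P. elementary_tensor n n (w (h j)) i)"
    unfolding det_tensor_def w[symmetric]
    by (rule ext, rule sum.reindex_bij_betw[OF h, symmetric])
  then have "sum_of_elementary_tensors n n (card ?P) (det_tensor n :: 'a tensor)"
    unfolding sum_of_elementary_tensors_def
    by (intro exI[of _ "\<lambda>j. w (h j)"]) (auto simp: w_def)
  then show ?thesis ..
qed

end

theory Submission
  imports
    Defs
    "HOL-Library.Cardinality"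
    "HOL-Analysis.Convex"
    "HOL-Real_Asymp.Real_Asymp"
    "Jordan_Normal_Form.Determinant"
begin

text \<open>
  Write the determinant tensor as a sum of \<open>r\<close> elementary tensors and contract its first \<open>m\<close> factors
  with a functional supported on the \<open>binomial(n, m)\<close> increasing multi-indices. A nonzero functional
  gives a nonzero alternating tensor of order \<open>n - m\<close>, whose rank is at least \<open>n - m\<close>. On the other
  hand, the contraction is a combination of \<open>r\<close> elementary tensors with coefficients that depend
  linearly on the functional, so at least \<open>n - m\<close> of them are nonzero: the coefficient vectors form a
  linear code of length \<open>r\<close>, dimension \<open>binomial(n, m)\<close> and minimum distance at least \<open>n - m\<close>.
  For \<open>m = \<lfloor>n/2\<rfloor>\<close> and \<open>n \<ge> 5\<close> this code corrects one error, and the Hamming bound gives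
  \<open>log\<^sub>q (r + 1) \<le> r - binomial(n, m)\<close>. By concavity of the logarithm this fails for every positive
  number below the root \<open>x\<close>.
\<close>

section \<open>The Hamming bound\<close>

definition hamming_dist :: "'i set \<Rightarrow> ('i \<Rightarrow> 'a) \<Rightarrow> ('i \<Rightarrow> 'a) \<Rightarrow> nat" where
  "hamming_dist I x y = card {i \<in> I. x i \<noteq> y i}"

definition hamming_ball :: "'i set \<Rightarrow> 'a set \<Rightarrow> ('i \<Rightarrow> 'a) \<Rightarrow> nat \<Rightarrow> ('i \<Rightarrow> 'a) set" where
  "hamming_ball I A x t = {y \<in> I \<rightarrow>\<^sub>E A. hamming_dist I x y \<le> t}"

lemma hamming_dist_commute: "hamming_dist I x y = hamming_dist I y x"
  by (simp add: hamming_dist_def eq_commute)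

lemma hamming_dist_triangle:
  assumes "finite I"
  shows "hamming_dist I x z \<le> hamming_dist I x y + hamming_dist I y z"
proof -
  have "hamming_dist I x z \<le> card ({i \<in> I. x i \<noteq> y i} \<union> {i \<in> I. y i \<noteq> z i})"
    unfolding hamming_dist_def using assms by (intro card_mono) auto
  then show ?thesis
    unfolding hamming_dist_def using card_Un_le le_trans by blast
qed

lemma card_words_differing_on:
  assumes "finite I" and "x \<in> I \<rightarrow> A" and "E \<subseteq> I"
  shows "card {y \<in> I \<rightarrow>\<^sub>E A. {i \<in> I. x i \<noteq> y i} = E} = (card A - 1) ^ card E"
proof -
  have "{y \<in> I \<rightarrow>\<^sub>E A. {i \<in> I. x i \<noteq> y i} = E} = (\<Pi>\<^sub>E i\<in>I. if i \<in> E then A - {x i} else {x i})"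
    using assms(2,3) by (fastforce simp: PiE_iff split: if_splits)
  then have "card {y \<in> I \<rightarrow>\<^sub>E A. {i \<in> I. x i \<noteq> y i} = E} =
      (\<Prod>i\<in>I. card (if i \<in> E then A - {x i} else {x i}))"
    using assms(1) by (simp add: card_PiE)
  also have "\<dots> = (\<Prod>i\<in>I. if i \<in> E then card A - 1 else 1)"
    using assms(2) by (intro prod.cong) (auto simp: card_Diff_singleton_if Pi_iff)
  also have "\<dots> = (card A - 1) ^ card E"
    using assms(1,3) by (simp add: prod.If_cases Int_absorb1)
  finally show ?thesis .
qed

lemma card_hamming_ball:
  assumes "finite I" and "finite A" and "x \<in> I \<rightarrow> A"
  shows "card (hamming_ball I A x t) = (\<Sum>i\<le>t. (card I choose i) * (card A - 1) ^ i)"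
proof -
  define \<E> where "\<E> = {E. E \<subseteq> I \<and> card E \<le> t}"
  have "finite \<E>"
    using assms(1) by (simp add: \<E>_def)
  have "hamming_ball I A x t = (\<Union>E\<in>\<E>. {y \<in> I \<rightarrow>\<^sub>E A. {i \<in> I. x i \<noteq> y i} = E})"
    by (auto simp: hamming_ball_def hamming_dist_def \<E>_def)
  also have "card \<dots> = (\<Sum>E\<in>\<E>. card {y \<in> I \<rightarrow>\<^sub>E A. {i \<in> I. x i \<noteq> y i} = E})"
    using assms(1,2) \<open>finite \<E>\<close> by (intro card_UN_disjoint) (auto simp: finite_PiE)
  also have "\<dots> = (\<Sum>E\<in>\<E>. (card A - 1) ^ card E)"
    using assms(1,3) by (intro sum.cong card_words_differing_on) (auto simp: \<E>_def)
  also have "\<dots> = (\<Sum>i\<le>t. \<Sum>E | E \<in> \<E> \<and> card E = i. (card A - 1) ^ card E)"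
    using \<open>finite \<E>\<close> by (intro sum.group[symmetric]) (auto simp: \<E>_def)
  also have "\<dots> = (\<Sum>i\<le>t. card {E. E \<subseteq> I \<and> card E = i} * (card A - 1) ^ i)"
  proof (intro sum.cong refl)
    fix i assume "i \<in> {..t}"
    then have "{E. E \<in> \<E> \<and> card E = i} = {E. E \<subseteq> I \<and> card E = i}"
      by (auto simp: \<E>_def)
    then show "(\<Sum>E | E \<in> \<E> \<and> card E = i. (card A - 1) ^ card E) =
        card {E. E \<subseteq> I \<and> card E = i} * (card A - 1) ^ i"
      by simp
  qed
  finally show ?thesis
    using assms(1) by (simp add: n_subsets)
qed

theorem hamming_bound:
  assumes "finite I" and "finite A" and "finite W" and code: "code \<in> W \<rightarrow> (I \<rightarrow>\<^sub>E A)"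
    and dist: "\<And>w w'. w \<in> W \<Longrightarrow> w' \<in> W \<Longrightarrow> w \<noteq> w' \<Longrightarrow> 2 * t < hamming_dist I (code w) (code w')"
  shows "card W * (\<Sum>i\<le>t. (card I choose i) * (card A - 1) ^ i) \<le> card A ^ card I"
proof -
  have fin: "finite (I \<rightarrow>\<^sub>E A)"
    using assms(1,2) by (simp add: finite_PiE)
  have disjoint: "hamming_ball I A (code w) t \<inter> hamming_ball I A (code w') t = {}"
    if "w \<in> W" "w' \<in> W" "w \<noteq> w'" for w w'
  proof (rule ccontr)
    assume "\<not> ?thesis"
    then obtain z where "hamming_dist I (code w) z \<le> t" "hamming_dist I (code w') z \<le> t"
      by (auto simp: hamming_ball_def)
    then show False
      using dist[OF that] hamming_dist_triangle[OF assms(1), of "code w" "code w'" z]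
        hamming_dist_commute[of I "code w'" z]
      by linarith
  qed
  have "code w \<in> I \<rightarrow> A" if "w \<in> W" for w
    using code that by (auto simp: PiE_def)
  then have "card W * (\<Sum>i\<le>t. (card I choose i) * (card A - 1) ^ i) =
      (\<Sum>w\<in>W. card (hamming_ball I A (code w) t))"
    using assms(1,2) by (simp add: card_hamming_ball)
  also have "\<dots> = card (\<Union>w\<in>W. hamming_ball I A (code w) t)"
    using fin assms(3) disjoint
    by (intro card_UN_disjoint[symmetric]) (auto simp: hamming_ball_def)
  also have "\<dots> \<le> card (I \<rightarrow>\<^sub>E A)"
    by (intro card_mono fin) (auto simp: hamming_ball_def)
  finally show ?thesis
    using assms(1) by (simp add: card_PiE)
qed

section \<open>Alternating tensors\<close>

lemma det_mult_eq_0_if_inner_dim_less: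
  fixes A B :: "'a::comm_ring_1 mat"
  assumes A: "A \<in> carrier_mat d r" and B: "B \<in> carrier_mat r d" and "r < d"
  shows "det (A * B) = 0"
proof -
  define A' where "A' = mat d d (\<lambda>(i, j). if j < r then A $$ (i, j) else 0)"
  define B' where "B' = mat\<^sub>r d d (\<lambda>j. if j = r then 0\<^sub>v d else if j < r then row B j else 0\<^sub>v d)"
  have carrier: "A' \<in> carrier_mat d d" "B' \<in> carrier_mat d d"
    by (simp_all add: A'_def B'_def)
  have "A * B = A' * B'"
  proof (rule eq_matI)
    fix i j assume "i < dim_row (A' * B')" "j < dim_col (A' * B')"
    then have ij: "i < d" "j < d"
      using carrier by auto
    have "(A' * B') $$ (i, j) = (\<Sum>k<d. A' $$ (i, k) * B' $$ (k, j))"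
      using carrier ij by (simp add: scalar_prod_def atLeast0LessThan)
    also have "\<dots> = (\<Sum>k<r. A' $$ (i, k) * B' $$ (k, j))"
      using assms ij by (intro sum.mono_neutral_right) (auto simp: A'_def)
    also have "\<dots> = (A * B) $$ (i, j)"
      using assms ij by (simp add: scalar_prod_def atLeast0LessThan A'_def B'_def)
    finally show "(A * B) $$ (i, j) = (A' * B') $$ (i, j)"
      by simp
  qed (use A B carrier in auto)
  moreover have "det B' = 0"
    unfolding B'_def using B by (intro det_row_0) (auto simp: assms(3))
  ultimately show ?thesis
    using det_mult[OF carrier] by simp
qed

lemma inner_dim_ge_if_product_diagonal:
  fixes x y :: "nat \<Rightarrow> nat \<Rightarrow> 'a::idom"
  assumes "\<And>p p'. p < d \<Longrightarrow> p' < d \<Longrightarrow> (\<Sum>j<r. x p j * y j p') = 0 \<longleftrightarrow> p \<noteq> p'"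
  shows "d \<le> r"
proof (rule ccontr)
  assume "\<not> d \<le> r"
  define A where "A = mat d r (\<lambda>(p, j). x p j)"
  define B where "B = mat r d (\<lambda>(j, p). y j p)"
  have carrier: "A \<in> carrier_mat d r" "B \<in> carrier_mat r d"
    by (simp_all add: A_def B_def)
  have entry: "(A * B) $$ (p, p') = (\<Sum>j<r. x p j * y j p')" if "p < d" "p' < d" for p p'
    using that by (simp add: A_def B_def scalar_prod_def atLeast0LessThan)
  have "det (A * B) = prod_list (diag_mat (A * B))"
    using assms carrier by (intro det_upper_triangular[of _ d] upper_triangularI mult_carrier_mat)
      (auto simp: entry simp del: index_mult_mat(1))
  moreover have "0 \<notin> set (diag_mat (A * B))"
    using assms carrier by (auto simp: diag_mat_def entry simp del: index_mult_mat(1))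
  ultimately have "det (A * B) \<noteq> 0"
    by (simp add: prod_list_zero_iff)
  with det_mult_eq_0_if_inner_dim_less[OF carrier] \<open>\<not> d \<le> r\<close> show False
    by simp
qed

text \<open>
  The sign rule does not imply the vanishing on repeated indices in characteristic 2.
\<close>

definition alternating :: "nat \<Rightarrow> nat \<Rightarrow> 'a::field tensor \<Rightarrow> bool" where
  "alternating d n T \<longleftrightarrow> (\<forall>i\<in>multi_indices d n.
     (\<not> inj_on i {..<d} \<longrightarrow> T i = 0) \<and>
     (\<forall>a<d. \<forall>b<d. a \<noteq> b \<longrightarrow> T (i \<circ> transpose a b) = - T i))"

lemma multi_index_less: "i \<in> multi_indices d n \<Longrightarrow> k < d \<Longrightarrow> i k < n"
  by (auto simp: multi_indices_def)

lemma finite_multi_indices: "finite (multi_indices d n)"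
  by (simp add: multi_indices_def finite_PiE)

lemma multi_index_comp_transpose:
  assumes "i \<in> multi_indices d n" and "a < d" and "b < d"
  shows "i \<circ> transpose a b \<in> multi_indices d n"
  using assms by (auto simp: multi_indices_def PiE_iff extensional_def transpose_def)

definition swap_overwrite :: "(nat \<Rightarrow> nat) \<Rightarrow> nat \<Rightarrow> nat \<Rightarrow> nat \<Rightarrow> nat" where
  "swap_overwrite i p p' = (i \<circ> transpose 0 p')(0 := i p)"

lemma swap_overwrite_multi_index:
  assumes "i \<in> multi_indices d n" and "p < d" and "p' < d"
  shows "swap_overwrite i p p' \<in> multi_indices d n"
  using assms by (auto simp: swap_overwrite_def multi_indices_def PiE_iff extensional_def transpose_def)

lemma alternating_swap_overwrite_eq_0_iff:
  assumes T: "alternating d n T" and i: "i \<in> multi_indices d n" "T i \<noteq> 0"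
    and p: "p < d" "p' < d"
  shows "T (swap_overwrite i p p') = 0 \<longleftrightarrow> p \<noteq> p'"
proof (cases "p = p'")
  case True
  then have "swap_overwrite i p p' = i \<circ> transpose 0 p"
    by (auto simp: swap_overwrite_def fun_eq_iff)
  moreover have "T (i \<circ> transpose 0 p) \<noteq> 0"
    using T i p by (cases "p = 0") (auto simp: alternating_def)
  ultimately show ?thesis
    using True by simp
next
  case False
  define k where "k = transpose 0 p' p"
  have k: "k < d" "k \<noteq> 0"
    using p False by (auto simp: k_def transpose_def)
  then have "swap_overwrite i p p' k = swap_overwrite i p p' 0"
    by (simp add: swap_overwrite_def k_def)
  then have "\<not> inj_on (swap_overwrite i p p') {..<d}"
    using k inj_onD[of "swap_overwrite i p p'" "{..<d}" k 0] by auto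
  then show ?thesis
    using T False swap_overwrite_multi_index[OF i(1) p] by (auto simp: alternating_def)
qed

text \<open>
  The entries of \<open>T\<close> at the multi-indices \<open>swap_overwrite i p p'\<close> form a diagonal submatrix of the
  flattening of \<open>T\<close> that separates the first tensor factor from the others.
\<close>

theorem alternating_rank_ge_order:
  assumes T: "alternating d n T" and i: "i \<in> multi_indices d n" "T i \<noteq> 0"
    and "sum_of_elementary_tensors d n r T"
  shows "d \<le> r"
proof -
  obtain v where v: "T = (\<lambda>i. \<Sum>j<r. elementary_tensor d n (v j) i)"
    using assms(4) by (auto simp: sum_of_elementary_tensors_def)
  define x where "x p j = v j 0 $ i p" for p j
  define y where "y j p' = (\<Prod>k=1..<d. v j k $ i (transpose 0 p' k))" for j p'
  have "T (swap_overwrite i p p') = (\<Sum>j<r. x p j * y j p')" if p: "p < d" "p' < d" for p p'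
  proof -
    have "T (swap_overwrite i p p') = (\<Sum>j<r. \<Prod>k=0..<d. v j k $ swap_overwrite i p p' k)"
      using swap_overwrite_multi_index[OF i(1) p]
      by (simp add: v elementary_tensor_def atLeast0LessThan)
    also have "\<dots> = (\<Sum>j<r. x p j * y j p')"
      using p by (subst prod.atLeast_Suc_lessThan) (auto simp: x_def y_def swap_overwrite_def)
    finally show ?thesis .
  qed
  then have "(\<Sum>j<r. x p j * y j p') = 0 \<longleftrightarrow> p \<noteq> p'" if "p < d" "p' < d" for p p'
    using alternating_swap_overwrite_eq_0_iff[OF T i that] that by simp
  then show ?thesis
    by (rule inner_dim_ge_if_product_diagonal)
qed

section \<open>Contraction\<close>

definition append_index :: "nat \<Rightarrow> (nat \<Rightarrow> nat) \<Rightarrow> (nat \<Rightarrow> nat) \<Rightarrow> nat \<Rightarrow> nat" where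
  "append_index m f g k = (if k < m then f k else g (k - m))"

lemma append_index_multi_index:
  assumes "f \<in> multi_indices m n" and "g \<in> multi_indices e n"
  shows "append_index m f g \<in> multi_indices (m + e) n"
  using assms by (auto simp: append_index_def multi_indices_def PiE_iff extensional_def)

lemma inj_on_append_index_iff:
  "inj_on (append_index m f g) {..<m + e} \<longleftrightarrow>
    inj_on f {..<m} \<and> inj_on g {..<e} \<and> f ` {..<m} \<inter> g ` {..<e} = {}"
proof -
  have split: "{..<m + e} = {..<m} \<union> (+) m ` {..<e}"
    using image_add_atLeastLessThan[of m 0 e] by (auto simp: atLeast0LessThan)
  have disjoint: "{..<m} - (+) m ` {..<e} = {..<m}" "(+) m ` {..<e} - {..<m} = (+) m ` {..<e}"
    by auto
  have "inj_on (append_index m f g) {..<m} \<longleftrightarrow> inj_on f {..<m}"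
    by (intro inj_on_cong) (simp add: append_index_def)
  moreover have "inj_on (append_index m f g) ((+) m ` {..<e}) \<longleftrightarrow> inj_on g {..<e}"
    by (simp add: inj_on_def append_index_def)
  moreover have "append_index m f g ` {..<m} = f ` {..<m}"
    by (simp add: append_index_def)
  moreover have "append_index m f g ` (+) m ` {..<e} = g ` {..<e}"
    unfolding image_image by (simp add: append_index_def)
  ultimately show ?thesis
    by (simp add: split inj_on_Un disjoint)
qed

lemma append_index_comp_transpose:
  "append_index m f (g \<circ> transpose a b) = append_index m f g \<circ> transpose (m + a) (m + b)"
  by (auto simp: append_index_def transpose_def fun_eq_iff)

definition contraction ::
  "nat \<Rightarrow> nat \<Rightarrow> nat \<Rightarrow> (nat \<Rightarrow> nat) set \<Rightarrow> ((nat \<Rightarrow> nat) \<Rightarrow> 'a::field) \<Rightarrow> 'a tensor \<Rightarrow> 'a tensor"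
  where "contraction m e n \<F> c T =
    (\<lambda>g. if g \<in> multi_indices e n then \<Sum>f\<in>\<F>. c f * T (append_index m f g) else 0)"

definition pairing ::
  "nat \<Rightarrow> (nat \<Rightarrow> nat) set \<Rightarrow> ((nat \<Rightarrow> nat) \<Rightarrow> 'a::field) \<Rightarrow> (nat \<Rightarrow> 'a vec) \<Rightarrow> 'a"
  where "pairing m \<F> c v = (\<Sum>f\<in>\<F>. c f * (\<Prod>k<m. v k $ f k))"

lemma pairing_diff: "pairing m \<F> (\<lambda>f. c f - c' f) v = pairing m \<F> c v - pairing m \<F> c' v"
  by (simp add: pairing_def left_diff_distrib sum_subtractf)

lemma alternating_contraction:
  assumes T: "alternating (m + e) n T" and \<F>: "\<F> \<subseteq> multi_indices m n"
  shows "alternating e n (contraction m e n \<F> c T)"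
  unfolding alternating_def
proof (intro ballI conjI impI allI)
  fix g assume g: "g \<in> multi_indices e n"
  have append: "append_index m f g \<in> multi_indices (m + e) n" if "f \<in> \<F>" for f
    using that \<F> g by (blast intro: append_index_multi_index)
  {
    assume "\<not> inj_on g {..<e}"
    then have "T (append_index m f g) = 0" if "f \<in> \<F>" for f
      using T append[OF that] by (simp add: alternating_def inj_on_append_index_iff)
    then show "contraction m e n \<F> c T g = 0"
      by (simp add: contraction_def)
  next
    fix a b assume ab: "a < e" "b < e" "a \<noteq> b"
    then have "T (append_index m f (g \<circ> transpose a b)) = - T (append_index m f g)" if "f \<in> \<F>" for f
      using T append[OF that] by (simp add: alternating_def append_index_comp_transpose)
    then show "contraction m e n \<F> c T (g \<circ> transpose a b) = - contraction m e n \<F> c T g"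
      using g multi_index_comp_transpose[OF g ab(1,2)]
      by (simp add: contraction_def flip: sum_negf)
  }
qed

lemma prod_lessThan_add:
  fixes h :: "nat \<Rightarrow> 'a::comm_monoid_mult"
  shows "(\<Prod>k<m + e. h k) = (\<Prod>k<m. h k) * (\<Prod>k<e. h (m + k))"
  by (induction e) (simp_all add: mult.assoc)

lemma contraction_elementary_tensor:
  assumes "\<F> \<subseteq> multi_indices m n"
  shows "contraction m e n \<F> c (elementary_tensor (m + e) n v) =
    (\<lambda>g. pairing m \<F> c v * elementary_tensor e n (\<lambda>k. v (m + k)) g)"
proof
  fix g
  show "contraction m e n \<F> c (elementary_tensor (m + e) n v) g =
      pairing m \<F> c v * elementary_tensor e n (\<lambda>k. v (m + k)) g"
  proof (cases "g \<in> multi_indices e n")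
    case True
    have "elementary_tensor (m + e) n v (append_index m f g) =
        (\<Prod>k<m. v k $ f k) * elementary_tensor e n (\<lambda>k. v (m + k)) g" if "f \<in> \<F>" for f
    proof -
      have "append_index m f g \<in> multi_indices (m + e) n"
        using that assms True by (blast intro: append_index_multi_index)
      then show ?thesis
        using True by (simp add: elementary_tensor_def prod_lessThan_add append_index_def)
    qed
    then show ?thesis
      using True by (simp add: contraction_def pairing_def sum_distrib_right mult.assoc)
  qed (simp add: contraction_def elementary_tensor_def)
qed

lemma contraction_sum:
  "contraction m e n \<F> c (\<lambda>i. \<Sum>j\<in>J. T j i) = (\<lambda>g. \<Sum>j\<in>J. contraction m e n \<F> c (T j) g)"
  by (simp add: contraction_def fun_eq_iff sum_distrib_left sum.swap[of _ J \<F>])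

lemma sum_of_elementary_tensors_scaled_sum:
  assumes "finite J" and "0 < d" and v: "\<And>j k. j \<in> J \<Longrightarrow> k < d \<Longrightarrow> v j k \<in> carrier_vec n"
  shows "sum_of_elementary_tensors d n (card J) (\<lambda>i. \<Sum>j\<in>J. a j * elementary_tensor d n (v j) i)"
proof -
  define w where "w j = (v j)(0 := a j \<cdot>\<^sub>v v j 0)" for j
  have w: "elementary_tensor d n (w j) i = a j * elementary_tensor d n (v j) i" if "j \<in> J" for j i
  proof (cases "i \<in> multi_indices d n")
    case True
    have "(a j \<cdot>\<^sub>v v j 0) $ i 0 = a j * v j 0 $ i 0"
      using v[OF that assms(2)] multi_index_less[OF True assms(2)] by auto
    then have "(\<Prod>k=0..<d. w j k $ i k) = a j * (\<Prod>k=0..<d. v j k $ i k)"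
      using assms(2) by (simp add: prod.atLeast_Suc_lessThan w_def)
    then show ?thesis
      using True by (simp add: elementary_tensor_def atLeast0LessThan)
  qed (simp add: elementary_tensor_def)
  obtain h where h: "bij_betw h {..<card J} J"
    using ex_bij_betw_nat_finite[OF assms(1)] by (auto simp: atLeast0LessThan)
  have "(\<lambda>i. \<Sum>j\<in>J. a j * elementary_tensor d n (v j) i) =
      (\<lambda>i. \<Sum>j<card J. elementary_tensor d n (w (h j)) i)"
    by (simp add: w sum.reindex_bij_betw[OF h, symmetric] bij_betw_apply[OF h])
  moreover have "w (h j) k \<in> carrier_vec n" if "j < card J" "k < d" for j k
    using v[of "h j"] that assms(2) bij_betw_apply[OF h, of j] by (simp add: w_def)
  ultimately show ?thesis
    unfolding sum_of_elementary_tensors_def by (intro exI[of _ "\<lambda>j. w (h j)"]) simp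
qed

lemma contraction_sum_of_elementary_tensors:
  fixes v :: "nat \<Rightarrow> nat \<Rightarrow> 'a::field vec"
  assumes "\<F> \<subseteq> multi_indices m n" and "0 < e"
    and v: "\<And>j k. j < r \<Longrightarrow> k < m + e \<Longrightarrow> v j k \<in> carrier_vec n"
  shows "sum_of_elementary_tensors e n (card {j\<in>{..<r}. pairing m \<F> c (v j) \<noteq> 0})
    (contraction m e n \<F> c (\<lambda>i. \<Sum>j<r. elementary_tensor (m + e) n (v j) i))"
proof -
  let ?J = "{j\<in>{..<r}. pairing m \<F> c (v j) \<noteq> 0}"
  have "contraction m e n \<F> c (\<lambda>i. \<Sum>j<r. elementary_tensor (m + e) n (v j) i) =
      (\<lambda>g. \<Sum>j<r. pairing m \<F> c (v j) * elementary_tensor e n (\<lambda>k. v j (m + k)) g)"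
    by (simp add: contraction_sum contraction_elementary_tensor[OF assms(1)])
  also have "\<dots> = (\<lambda>g. \<Sum>j\<in>?J. pairing m \<F> c (v j) * elementary_tensor e n (\<lambda>k. v j (m + k)) g)"
    by (intro ext sum.mono_neutral_right) auto
  finally show ?thesis
    by (simp only:) (intro sum_of_elementary_tensors_scaled_sum, use assms(2) v in auto)
qed

text \<open>
  For a tensor \<open>\<Sum>j<r. v j 0 \<otimes> \<dots> \<otimes> v j (d - 1)\<close>, the weight of the codeword of \<open>c\<close> bounds the rank of
  the contraction by \<open>c\<close> from above.
\<close>

definition codeword ::
  "nat \<Rightarrow> (nat \<Rightarrow> nat) set \<Rightarrow> nat \<Rightarrow> (nat \<Rightarrow> nat \<Rightarrow> 'a vec) \<Rightarrow> ((nat \<Rightarrow> nat) \<Rightarrow> 'a::field) \<Rightarrow> nat \<Rightarrow> 'a"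
  where "codeword m \<F> r v c = (\<lambda>j\<in>{..<r}. pairing m \<F> c (v j))"

lemma hamming_dist_codeword:
  "hamming_dist {..<r} (codeword m \<F> r v c) (codeword m \<F> r v c') =
    card {j\<in>{..<r}. pairing m \<F> (\<lambda>f. c f - c' f) (v j) \<noteq> 0}"
  unfolding hamming_dist_def
  by (intro arg_cong[of _ _ card]) (auto simp: pairing_diff codeword_def)

theorem contraction_hamming_bound:
  fixes T :: "'a::{field,finite} tensor"
  assumes "sum_of_elementary_tensors (m + e) n r T" and "0 < e" and \<F>: "\<F> \<subseteq> multi_indices m n"
    and rank: "\<And>c f s. f \<in> \<F> \<Longrightarrow> c f \<noteq> 0 \<Longrightarrow>
      sum_of_elementary_tensors e n s (contraction m e n \<F> c T) \<Longrightarrow> 2 * t < s"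
  shows "CARD('a) ^ card \<F> * (\<Sum>i\<le>t. (r choose i) * (CARD('a) - 1) ^ i) \<le> CARD('a) ^ r"
proof -
  obtain v :: "nat \<Rightarrow> nat \<Rightarrow> 'a vec" where v: "\<And>j k. j < r \<Longrightarrow> k < m + e \<Longrightarrow> v j k \<in> carrier_vec n"
    and T: "T = (\<lambda>i. \<Sum>j<r. elementary_tensor (m + e) n (v j) i)"
    using assms(1) by (auto simp: sum_of_elementary_tensors_def)
  define W where "W = \<F> \<rightarrow>\<^sub>E (UNIV :: 'a set)"
  have dist: "2 * t < hamming_dist {..<r} (codeword m \<F> r v c) (codeword m \<F> r v c')"
    if "c \<in> W" "c' \<in> W" "c \<noteq> c'" for c c'
  proof -
    let ?d = "\<lambda>f. c f - c' f"
    obtain f where f: "?d f \<noteq> 0"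
      using \<open>c \<noteq> c'\<close> by (auto simp: fun_eq_iff)
    then have "f \<in> \<F>"
      using that(1,2) PiE_arb[of c \<F> _ f] PiE_arb[of c' \<F> _ f] unfolding W_def by force
    moreover have "sum_of_elementary_tensors e n (card {j\<in>{..<r}. pairing m \<F> ?d (v j) \<noteq> 0})
        (contraction m e n \<F> ?d T)"
      unfolding T using \<F> \<open>0 < e\<close> v by (rule contraction_sum_of_elementary_tensors)
    ultimately show ?thesis
      unfolding hamming_dist_codeword using rank[of f ?d, OF _ f] by blast
  qed
  have finite: "finite \<F>"
    using \<F> finite_multi_indices by (rule finite_subset)
  have "card W * (\<Sum>i\<le>t. (card {..<r} choose i) * (CARD('a) - 1) ^ i) \<le> CARD('a) ^ card {..<r}"
  proof (rule hamming_bound)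
    show "codeword m \<F> r v \<in> W \<rightarrow> {..<r} \<rightarrow>\<^sub>E UNIV"
      by (intro Pi_I) (simp add: codeword_def restrict_PiE_iff)
    show "finite W"
      using finite by (simp add: W_def finite_PiE)
  qed (use dist in simp_all)
  then show ?thesis
    using finite by (simp add: W_def card_PiE)
qed

section \<open>The determinant tensor\<close>

lemma det_tensor_eq_det:
  assumes "i \<in> multi_indices n n"
  shows "(det_tensor n i :: 'a::field) = det (mat n n (\<lambda>(k, l). 1\<^sub>m n $$ (i k, l)))"
proof -
  have "elementary_tensor n n (\<lambda>k. unit_vec n (\<sigma> k)) i =
      (\<Prod>k=0..<n. mat n n (\<lambda>(k, l). 1\<^sub>m n $$ (i k, l)) $$ (k, \<sigma> k) :: 'a)"
    if "\<sigma> permutes {..<n}" for \<sigma>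
    unfolding elementary_tensor_def atLeast0LessThan
    using assms multi_index_less[OF assms] permutes_in_image[OF that]
    by (auto intro!: prod.cong)
  then show ?thesis
    by (simp add: det_tensor_def det_def'[of _ n] atLeast0LessThan)
qed

lemma alternating_det_tensor: "alternating n n (det_tensor n :: 'a::field tensor)"
  unfolding alternating_def
proof (intro ballI conjI impI allI)
  fix i assume i: "i \<in> multi_indices n n"
  define A :: "'a mat" where "A = mat n n (\<lambda>(k, l). 1\<^sub>m n $$ (i k, l))"
  have A: "A \<in> carrier_mat n n"
    by (simp add: A_def)
  {
    assume "\<not> inj_on i {..<n}"
    then obtain a b where "a < n" "b < n" "a \<noteq> b" "i a = i b"
      by (auto simp: inj_on_def)
    moreover from this have "row A a = row A b"
      by (intro eq_vecI) (simp_all add: A_def)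
    ultimately show "det_tensor n i = (0 :: 'a)"
      using det_identical_rows[OF A] by (simp add: det_tensor_eq_det[OF i] A_def)
  next
    fix a b assume ab: "a < n" "b < n" "a \<noteq> b"
    then have "transpose a b permutes {0..<n}"
      by (intro permutes_swap_id) simp_all
    then have "det (mat n n (\<lambda>(k, l). A $$ (transpose a b k, l))) = - det A"
      using det_permute_rows[OF A] ab by (simp add: sign_swap_id)
    also have "mat n n (\<lambda>(k, l). A $$ (transpose a b k, l)) =
        mat n n (\<lambda>(k, l). 1\<^sub>m n $$ ((i \<circ> transpose a b) k, l))"
      using ab by (intro eq_matI) (auto simp: A_def transpose_def)
    finally show "det_tensor n (i \<circ> transpose a b) = - (det_tensor n i :: 'a)"
      using multi_index_comp_transpose[OF i ab(1,2)] i by (simp add: det_tensor_eq_det A_def)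
  }
qed

lemma det_tensor_eq_0_iff:
  assumes i: "i \<in> multi_indices n n"
  shows "det_tensor n i = (0 :: 'a::field) \<longleftrightarrow> \<not> inj_on i {..<n}"
proof
  assume "\<not> inj_on i {..<n}"
  then show "det_tensor n i = (0 :: 'a)"
    using alternating_det_tensor i unfolding alternating_def by blast
next
  assume zero: "det_tensor n i = (0 :: 'a)"
  show "\<not> inj_on i {..<n}"
  proof
    assume inj: "inj_on i {..<n}"
    define \<pi> where "\<pi> k = (if k < n then i k else k)" for k
    have "i ` {..<n} \<subseteq> {..<n}"
      using i by (auto simp: multi_indices_def)
    then have "bij_betw i {..<n} {..<n}"
      using inj endo_inj_surj[of "{..<n}" i] by (simp add: bij_betw_def)
    then have "bij_betw \<pi> {..<n} {..<n}"
      by (rule bij_betw_cong[THEN iffD1, rotated]) (simp add: \<pi>_def)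
    then have \<pi>: "\<pi> permutes {0..<n}"
      by (intro bij_imp_permutes) (simp_all add: \<pi>_def atLeast0LessThan)
    have "det_tensor n i = det (mat n n (\<lambda>(k, l). 1\<^sub>m n $$ (\<pi> k, l)) :: 'a mat)"
      unfolding det_tensor_eq_det[OF i] by (intro arg_cong[of _ _ det] eq_matI) (simp_all add: \<pi>_def)
    also have "\<dots> = of_int (sign \<pi>)"
      by (simp add: det_permute_rows[OF one_carrier_mat \<pi>])
    finally have "det_tensor n i = (of_int (sign \<pi>) :: 'a)" .
    with zero show False
      by (simp add: sign_def split: if_splits)
  qed
qed

definition increasing_multi_indices :: "nat \<Rightarrow> nat \<Rightarrow> (nat \<Rightarrow> nat) set" where
  "increasing_multi_indices m n = {f \<in> multi_indices m n. strict_mono_on {..<m} f}"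

lemma strict_sorted_map_upt_iff:
  "sorted_wrt (<) (map f [0..<m]) \<longleftrightarrow> strict_mono_on {..<m} (f :: nat \<Rightarrow> nat)"
  by (auto simp: sorted_wrt_iff_nth_less strict_mono_on_def)

lemma bij_betw_increasing_multi_indices:
  "bij_betw (\<lambda>f. f ` {..<m}) (increasing_multi_indices m n) {S. S \<subseteq> {..<n} \<and> card S = m}"
proof (intro bij_betw_imageI inj_onI subset_antisym subsetI)
  fix f g assume f: "f \<in> increasing_multi_indices m n" and g: "g \<in> increasing_multi_indices m n"
    and "f ` {..<m} = g ` {..<m}"
  then have "map f [0..<m] = map g [0..<m]"
    by (intro strict_sorted_equal)
      (simp_all add: strict_sorted_map_upt_iff increasing_multi_indices_def atLeast0LessThan)
  then have "f k = g k" if "k < m" for k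
    using that by (simp add: map_eq_conv)
  then show "f = g"
    using f g by (intro extensionalityI[of _ "{..<m}"])
      (auto simp: increasing_multi_indices_def multi_indices_def PiE_def)
next
  fix S assume "S \<in> (\<lambda>f. f ` {..<m}) ` increasing_multi_indices m n"
  then obtain f where f: "f \<in> multi_indices m n" "strict_mono_on {..<m} f" and S: "S = f ` {..<m}"
    by (auto simp: increasing_multi_indices_def)
  have "S \<subseteq> {..<n}"
    using multi_index_less[OF f(1)] by (auto simp: S)
  moreover have "card S = m"
    using card_image[OF strict_mono_on_imp_inj_on[OF f(2)]] by (simp add: S)
  ultimately show "S \<in> {S. S \<subseteq> {..<n} \<and> card S = m}"
    by simp
next
  fix S assume S: "S \<in> {S. S \<subseteq> {..<n} \<and> card S = m}"
  define f where "f = (\<lambda>k\<in>{..<m}. sorted_list_of_set S ! k)"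
  have "finite S"
    using S by (auto intro: finite_subset)
  then have map_f: "map f [0..<m] = sorted_list_of_set S"
    using S by (intro nth_equalityI) (simp_all add: f_def)
  then have image_f: "f ` {..<m} = S"
    using \<open>finite S\<close> by (metis set_map set_upt atLeast0LessThan set_sorted_list_of_set)
  moreover have "strict_mono_on {..<m} f"
    using map_f strict_sorted_map_upt_iff by (metis strict_sorted_list_of_set)
  moreover have "f \<in> multi_indices m n"
    using S image_f by (auto simp: multi_indices_def f_def)
  ultimately show "S \<in> (\<lambda>f. f ` {..<m}) ` increasing_multi_indices m n"
    by (auto simp: increasing_multi_indices_def)
qed

lemma card_increasing_multi_indices: "card (increasing_multi_indices m n) = n choose m"
  using bij_betw_same_card[OF bij_betw_increasing_multi_indices] by (simp add: n_subsets)

lemma increasing_multi_indices_subset: "increasing_multi_indices m n \<subseteq> multi_indices m n"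
  by (auto simp: increasing_multi_indices_def)

lemma inj_on_increasing_multi_index: "f \<in> increasing_multi_indices m n \<Longrightarrow> inj_on f {..<m}"
  by (simp add: increasing_multi_indices_def strict_mono_on_imp_inj_on)

lemma complementary_increasing_multi_index:
  assumes f: "f \<in> increasing_multi_indices m (m + e)"
  obtains g where "g \<in> increasing_multi_indices e (m + e)" and "g ` {..<e} = {..<m + e} - f ` {..<m}"
proof -
  have "f ` {..<m} \<subseteq> {..<m + e}" "card (f ` {..<m}) = m"
    using bij_betwE[OF bij_betw_increasing_multi_indices] f by auto
  then have "card ({..<m + e} - f ` {..<m}) = e"
    by (simp add: card_Diff_subset)
  then have "{..<m + e} - f ` {..<m} \<in> (\<lambda>g. g ` {..<e}) ` increasing_multi_indices e (m + e)"
    unfolding bij_betw_imp_surj_on[OF bij_betw_increasing_multi_indices] by auto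
  then show thesis
    using that by auto
qed

lemma inj_on_append_complementary_iff:
  assumes f: "f \<in> increasing_multi_indices m n" and f': "f' \<in> increasing_multi_indices m n"
    and g: "g \<in> increasing_multi_indices e n" "g ` {..<e} = {..<n} - f ` {..<m}"
  shows "inj_on (append_index m f' g) {..<m + e} \<longleftrightarrow> f' = f"
proof -
  have image: "h ` {..<m} \<subseteq> {..<n}" "card (h ` {..<m}) = m" if "h \<in> increasing_multi_indices m n" for h
    using bij_betwE[OF bij_betw_increasing_multi_indices] that by auto
  have "inj_on (append_index m f' g) {..<m + e} \<longleftrightarrow> f' ` {..<m} \<inter> g ` {..<e} = {}"
    using f' g(1) by (simp add: inj_on_append_index_iff inj_on_increasing_multi_index)
  also have "\<dots> \<longleftrightarrow> f' ` {..<m} \<subseteq> f ` {..<m}"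
    using image(1)[OF f'] unfolding g(2) by auto
  also have "\<dots> \<longleftrightarrow> f' ` {..<m} = f ` {..<m}"
    using image(2)[OF f] image(2)[OF f']
    by (metis card_subset_eq finite_imageI finite_lessThan subset_refl)
  also have "\<dots> \<longleftrightarrow> f' = f"
    using inj_on_eq_iff[OF bij_betw_imp_inj_on[OF bij_betw_increasing_multi_indices] f' f] .
  finally show ?thesis .
qed

lemma contraction_det_tensor_nonzero:
  fixes c :: "(nat \<Rightarrow> nat) \<Rightarrow> 'a::field"
  assumes f: "f \<in> increasing_multi_indices m (m + e)" and "c f \<noteq> 0"
  obtains g where "g \<in> multi_indices e (m + e)"
    and "contraction m e (m + e) (increasing_multi_indices m (m + e)) c (det_tensor (m + e)) g \<noteq> 0"
proof -
  let ?\<F> = "increasing_multi_indices m (m + e)"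
  obtain g where g: "g \<in> increasing_multi_indices e (m + e)" "g ` {..<e} = {..<m + e} - f ` {..<m}"
    using complementary_increasing_multi_index[OF f] .
  then have multi_index: "g \<in> multi_indices e (m + e)"
    using increasing_multi_indices_subset by blast
  have "append_index m f' g \<in> multi_indices (m + e) (m + e)" if "f' \<in> ?\<F>" for f'
    using that multi_index increasing_multi_indices_subset by (blast intro: append_index_multi_index)
  then have det: "det_tensor (m + e) (append_index m f' g) = (0 :: 'a) \<longleftrightarrow> f' \<noteq> f" if "f' \<in> ?\<F>" for f'
    using that inj_on_append_complementary_iff[OF f that g] by (simp add: det_tensor_eq_0_iff)
  have "finite ?\<F>"
    using increasing_multi_indices_subset finite_multi_indices by (rule finite_subset)
  then have "contraction m e (m + e) ?\<F> c (det_tensor (m + e)) g =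
      c f * det_tensor (m + e) (append_index m f g)"
    using f multi_index det by (simp add: contraction_def sum.remove[of _ f] sum.neutral)
  then show thesis
    using that[OF multi_index] det[OF f] \<open>c f \<noteq> 0\<close> by simp
qed

theorem det_tensor_hamming_bound:
  assumes "sum_of_elementary_tensors n n r (det_tensor n :: 'a::{field,finite} tensor)"
    and "m + 2 * t < n"
  shows "CARD('a) ^ (n choose m) * (\<Sum>i\<le>t. (r choose i) * (CARD('a) - 1) ^ i) \<le> CARD('a) ^ r"
proof -
  obtain e where n: "n = m + e" and e: "2 * t < e"
    using assms(2) less_imp_add_positive[of m n] by force
  let ?\<F> = "increasing_multi_indices m n"
  have rank: "2 * t < s" if f: "f \<in> ?\<F>" "c f \<noteq> 0"
    and s: "sum_of_elementary_tensors e n s (contraction m e n ?\<F> c (det_tensor n :: 'a tensor))" for c f s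
  proof -
    obtain g where "g \<in> multi_indices e n" "contraction m e n ?\<F> c (det_tensor n) g \<noteq> 0"
      using contraction_det_tensor_nonzero[of f m e c] f unfolding n by blast
    moreover have "alternating e n (contraction m e n ?\<F> c (det_tensor n))"
      using alternating_contraction[OF _ increasing_multi_indices_subset] alternating_det_tensor[of n]
      by (simp add: n)
    ultimately show ?thesis
      using alternating_rank_ge_order[OF _ _ _ s] e by fastforce
  qed
  have "CARD('a) ^ card ?\<F> * (\<Sum>i\<le>t. (r choose i) * (CARD('a) - 1) ^ i) \<le> CARD('a) ^ r"
    by (rule contraction_hamming_bound[OF _ _ increasing_multi_indices_subset rank])
      (use assms(1) e n in auto)
  then show ?thesis
    by (simp add: card_increasing_multi_indices)
qed

section \<open>The logarithmic equation\<close>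

lemma concave_on_le_crossing:
  fixes g :: "real \<Rightarrow> real"
  assumes "concave_on {0..} g" and "0 \<le> g 0" and "0 < N"
    and "0 \<le> x" and x: "g x = x - N" and "0 \<le> y" and y: "g y \<le> y - N"
  shows "x \<le> y"
proof (rule ccontr)
  assume "\<not> x \<le> y"
  define t where "t = y / x"
  have t: "0 \<le> t" "t < 1" "y = t * x"
    using assms(4,6) \<open>\<not> x \<le> y\<close> by (auto simp: t_def)
  have "y - N < t * (x - N)"
    using t assms(3) by (simp add: right_diff_distrib)
  also have "\<dots> \<le> (1 - t) * g 0 + t * g x"
    using t assms(2) x by simp
  also have "\<dots> \<le> g y"
    using concave_onD[OF assms(1), of t 0 x] t assms(4) by simp
  finally show False
    using y by simp
qed

lemma concave_on_log_add_one:
  fixes b :: real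
  assumes "1 < b"
  shows "concave_on {0..} (\<lambda>x. log b (x + 1))"
  unfolding concave_on_iff
proof (intro conjI ballI allI impI)
  fix x y u v :: real
  assume "x \<in> {0..}" "y \<in> {0..}" and uv: "0 \<le> u" "0 \<le> v" "u + v = 1"
  then have "u * log b (x + 1) + v * log b (y + 1) \<le> log b (u *\<^sub>R (x + 1) + v *\<^sub>R (y + 1))"
    using log_concave[OF assms] by (simp add: concave_on_iff)
  also have "u *\<^sub>R (x + 1) + v *\<^sub>R (y + 1) = u *\<^sub>R x + v *\<^sub>R y + 1"
    using uv by (simp add: distrib_left)
  finally show "u * log b (x + 1) + v * log b (y + 1) \<le> log b (u *\<^sub>R x + v *\<^sub>R y + 1)" .
qed simp

lemma log_add_one_crossing_le:
  fixes b N x y :: real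
  assumes "1 < b" and "0 < N" and "0 \<le> x" and "log b (x + 1) = x - N"
    and "0 \<le> y" and "log b (y + 1) \<le> y - N"
  shows "x \<le> y"
  by (rule concave_on_le_crossing[OF concave_on_log_add_one[OF assms(1)] _ assms(2-6)]) simp

lemma add_log_le_if_log_add_one_le:
  fixes b N y :: real
  assumes "1 < b" and "1 \<le> N" and "0 \<le> y" and y: "log b (y + 1) \<le> y - N"
  shows "N + log b N \<le> y"
proof -
  have "0 \<le> log b (y + 1)"
    using assms(1,3) by simp
  with y have "N \<le> y + 1"
    by linarith
  then have "log b N \<le> log b (y + 1)"
    using assms(1,2) by simp
  with y show ?thesis
    by linarith
qed

lemma ex1_log_add_one_crossing:
  fixes b N :: real
  assumes "1 < b" and "0 < N"
  shows "\<exists>!x. 0 < x \<and> log b (x + 1) = x - N"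
proof -
  have "eventually (\<lambda>x. log b (x + 1) \<le> x - N) at_top"
    using assms(1) by real_asymp
  then obtain u where "0 \<le> u" "log b (u + 1) \<le> u - N"
    using eventually_happens[OF eventually_conj[OF eventually_ge_at_top[of 0]]] by fastforce
  then have "\<exists>x\<ge>0. x \<le> u \<and> x - log b (x + 1) = N"
    using assms by (intro IVT') (auto intro!: continuous_intros)
  then obtain x where x: "0 \<le> x" "log b (x + 1) = x - N"
    by (auto simp: algebra_simps)
  with assms(2) have "x \<noteq> 0"
    by auto
  with x have "0 < x \<and> log b (x + 1) = x - N"
    by simp
  moreover have "y = x" if "0 < y \<and> log b (y + 1) = y - N" for y
    using log_add_one_crossing_le[OF assms, of x y] log_add_one_crossing_le[OF assms, of y x] that x
    by simp
  ultimately show ?thesis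
    by blast
qed

section \<open>The rank of the determinant tensor\<close>

lemma sum_of_elementary_tensors_det_tensor_rank:
  assumes "0 < n"
  shows "sum_of_elementary_tensors n n (tensor_rank n n (det_tensor n :: 'a tensor))
    (det_tensor n :: 'a::field tensor)"
  unfolding tensor_rank_def by (rule LeastI_ex[OF det_tensor_sum_of_elementary_tensors[OF assms]])

lemma log_tensor_rank_det_tensor_le:
  assumes "5 \<le> n"
  defines "r \<equiv> tensor_rank n n (det_tensor n :: 'a::{field,finite} tensor)"
  shows "log CARD('a) (real r + 1) \<le> real r - real (n choose (n div 2))"
proof -
  let ?q = "CARD('a)" and ?N = "n choose (n div 2)"
  have "card {0, 1 :: 'a} \<le> ?q"
    by (rule card_mono) simp_all
  then have q: "2 \<le> ?q"
    by simp
  then have "1 \<le> ?q - 1"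
    by linarith
  then have "r * 1 \<le> r * (?q - 1)"
    by (rule mult_le_mono2)
  then have "?q ^ ?N * (r + 1) \<le> ?q ^ ?N * (1 + r * (?q - 1))"
    by (intro mult_le_mono2) linarith
  also have "\<dots> \<le> ?q ^ r"
    using det_tensor_hamming_bound[where 'a = 'a, of n r "n div 2" 1] assms(1)
      sum_of_elementary_tensors_det_tensor_rank[where 'a = 'a, of n] by (simp add: r_def)
  finally have "real (?q ^ ?N * (r + 1)) \<le> real (?q ^ r)"
    by (rule of_nat_mono)
  then have "real ?q ^ ?N * (real r + 1) \<le> real ?q ^ r"
    by (simp add: algebra_simps)
  then have "log ?q (real ?q ^ ?N * (real r + 1)) \<le> log ?q (real ?q ^ r)"
    using q by (subst log_le_cancel_iff) auto
  then show ?thesis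
    using q by (simp add: log_mult log_nat_power)
qed

theorem theorem6p2:
  fixes q n :: nat
  assumes "primepow q"
    and "card (UNIV :: 'a::{field,finite} set) = q"
    and "n \<ge> 5"
  shows "(\<exists>!x::real. x > 0 \<and> log (real q) (x + 1) = x - real (n choose (n div 2))) \<and>
    (\<forall>x::real. x > 0 \<and> log (real q) (x + 1) = x - real (n choose (n div 2)) \<longrightarrow>
       int (tensor_rank n n (det_tensor n :: 'a tensor)) \<ge> \<lceil>x\<rceil>) \<and>
    real (tensor_rank n n (det_tensor n :: 'a tensor)) \<ge>
       real (n choose (n div 2)) + log (real q) (real (n choose (n div 2)))"
proof -
  define N where "N = real (n choose (n div 2))"
  define r where "r = tensor_rank n n (det_tensor n :: 'a tensor)"
  have q: "1 < real q"
    using primepow_gt_Suc_0[OF assms(1)] by simp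
  have N: "1 \<le> N"
    by (simp add: N_def Suc_leI)
  have log_le: "log q (real r + 1) \<le> real r - N"
    using log_tensor_rank_det_tensor_le[where 'a = 'a, of n] assms(2,3) by (simp add: N_def r_def)
  have "\<exists>!x. x > 0 \<and> log q (x + 1) = x - N"
    using ex1_log_add_one_crossing[OF q, of N] N by simp
  moreover have "\<lceil>x\<rceil> \<le> int r" if "x > 0" "log q (x + 1) = x - N" for x
    using log_add_one_crossing_le[OF q, of N x "real r"] that N log_le by (simp add: ceiling_le_iff)
  moreover have "N + log q N \<le> real r"
    using add_log_le_if_log_add_one_le[OF q N _ log_le] by simp
  ultimately show ?thesis
    by (simp add: N_def r_def)
qed

end
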